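(* Let $m\ge6$ be even, $h=\frac m2$, $f_7(x)=x+x^{2^{h+1}-1}+x^{2^m-2^{h+1}+2}\in\mathbb{F}_{2^m}[x]$, and let $s^\infty$ be the sequence $s_t=\operatorname{Tr}(f_7(\alpha^t+1))$, $t\ge0$. Then the minimal polynomial of $s^\infty$ (generator polynomial of $\mathcal{C}_s$) is $$g_s(x)=\prod_{i\in\Gamma_{(h)}\setminus\Gamma_{(h-1)}}m_{\alpha^{-(i+2^{h})}}(x)\prod_{j=1}^{h-2}\prod_{i\in\Gamma_{(j)}}m_{\alpha^{-(i+2^{j+1})}}(x),$$ the linear span of $s^\infty$ equals $m(2^{(m-2)/2}-1)$, and $\mathcal{C}_s$ has parameters $[2^m-1,\,2^m-1-m(2^{(m-2)/2}-1),\,d(\mathcal{C}_s)]$ with $2^{(m-4)/2}+1\le d(\mathcal{C}_s)\le 1+m(2^{(m-2)/2}-1)$.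
   Context: Let $v=2^m-1$, $\alpha$ a primitive element of $\mathbb{F}_{2^m}$, and $\operatorname{Tr}(x)=\sum_{i=0}^{m-1}x^{2^i}$ the absolute trace from $\mathbb{F}_{2^m}$ to $\mathbb{F}_2$. For a polynomial $F$ over $\mathbb{F}_{2^m}$ the binary sequence $s^\infty=(s_t)_{t\ge0}$ is defined by $s_t=\operatorname{Tr}(F(\alpha^t+1))$; it is periodic with period dividing $v$. Its minimal polynomial $g_s(x)$ is the polynomial $1+c_1x+\dots+c_Lx^L\in\mathbb{F}_2[x]$ of least degree $L$ such that $s_i+c_1s_{i-1}+\dots+c_Ls_{i-L}=0$ for all $i\ge L$; its degree $L_s$ is the linear span of $s^\infty$. $\mathcal{C}_s$ denotes the binary cyclic code of length $v$ with generator polynomial $g_s(x)$. For an integer $i$, $m_{\alpha^i}(x)$ is the minimal polynomial of $\alpha^i$ over $\mathbb{F}_2$. For a positive integer $t$, $\Gamma_{(t)}=\{j:1\le j\le 2^t-1,\ j\text{ odd}\}$. $d(\mathcal{C})$ denotes minimum Hamming distance. *)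

theory Defs
  imports "HOL-Computational_Algebra.Polynomial"
begin

text \<open>The field F_{2^m} is modelled by a finite field type 'a with CARD('a) = 2^m;
  the prime field F_2 is the subset {0,1} of 'a.\<close>

definition binary :: "'a::field \<Rightarrow> bool" where
  "binary x \<longleftrightarrow> x = 0 \<or> x = 1"

definition binary_poly :: "'a::field poly \<Rightarrow> bool" where
  "binary_poly p \<longleftrightarrow> (\<forall>i. binary (coeff p i))"

definition trace :: "nat \<Rightarrow> 'a::field \<Rightarrow> 'a" where
  "trace m x = (\<Sum>i<m. x ^ (2 ^ i))"

definition primitive :: "'a::{finite,field} \<Rightarrow> bool" where
  "primitive a \<longleftrightarrow> a \<noteq> 0 \<and> (\<forall>x. x \<noteq> 0 \<longrightarrow> (\<exists>k::nat. x = a ^ k))"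

definition is_min_poly_F2 :: "'a::field \<Rightarrow> 'a poly \<Rightarrow> bool" where
  "is_min_poly_F2 b p \<longleftrightarrow> lead_coeff p = 1 \<and> binary_poly p \<and> poly p b = 0 \<and>
     (\<forall>q. q \<noteq> 0 \<and> binary_poly q \<and> poly q b = 0 \<longrightarrow> degree p \<le> degree q)"

definition min_poly_F2 :: "'a::field \<Rightarrow> 'a poly" where
  "min_poly_F2 b = (THE p. is_min_poly_F2 b p)"

definition lin_rec :: "'a::field poly \<Rightarrow> (nat \<Rightarrow> 'a) \<Rightarrow> bool" where
  "lin_rec p s \<longleftrightarrow> (\<forall>i\<ge>degree p. (\<Sum>k\<le>degree p. coeff p k * s (i - k)) = 0)"

definition is_seq_min_poly :: "(nat \<Rightarrow> 'a::field) \<Rightarrow> 'a poly \<Rightarrow> bool" where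
  "is_seq_min_poly s g \<longleftrightarrow> coeff g 0 = 1 \<and> binary_poly g \<and> lin_rec g s \<and>
     (\<forall>q. coeff q 0 = 1 \<and> binary_poly q \<and> lin_rec q s \<longrightarrow> degree g \<le> degree q)"

definition seq_min_poly :: "(nat \<Rightarrow> 'a::field) \<Rightarrow> 'a poly" where
  "seq_min_poly s = (THE g. is_seq_min_poly s g)"

definition linear_span :: "(nat \<Rightarrow> 'a::field) \<Rightarrow> nat" where
  "linear_span s = degree (seq_min_poly s)"

text \<open>Binary cyclic code of length v generated by g: the ideal generated by g in
  F_2[x]/(x^v - 1); codewords are represented by binary polynomials of degree < v.\<close>
definition cyclic_code :: "nat \<Rightarrow> 'a::field poly \<Rightarrow> 'a poly set" where
  "cyclic_code v g = {(a * g) mod (monom 1 v - 1) | a. binary_poly a}"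

definition hamming_dist :: "nat \<Rightarrow> 'a::field poly \<Rightarrow> 'a poly \<Rightarrow> nat" where
  "hamming_dist v c c' = card {i. i < v \<and> coeff c i \<noteq> coeff c' i}"

definition min_dist :: "nat \<Rightarrow> 'a::field poly set \<Rightarrow> nat" where
  "min_dist v C = Min {hamming_dist v c c' | c c'. c \<in> C \<and> c' \<in> C \<and> c \<noteq> c'}"

definition Gamma :: "nat \<Rightarrow> nat set" where
  "Gamma t = {j. 1 \<le> j \<and> j \<le> 2 ^ t - 1 \<and> odd j}"

definition f7 :: "nat \<Rightarrow> 'a::field \<Rightarrow> 'a" where
  "f7 m x = x + x ^ (2 ^ (m div 2 + 1) - 1) + x ^ (2 ^ m - 2 ^ (m div 2 + 1) + 2)"

end

theory Submission
  imports Defs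
begin

text \<open>
  Write \<open>T(n) = Tr(x^n)\<close>, so \<open>T(2n) = T(n)\<close>. In characteristic two
  \<open>(x + 1)^(2^k - 1)\<close> is the sum of all \<open>x^i\<close> with \<open>i < 2^k\<close>; expanding the two high powers in
  \<open>f7 (x + 1)\<close> this way and cancelling equal terms leaves \<open>T(1)\<close> plus the sum of \<open>T\<close> over
  \<open>[2^(h-1), 2^h)\<close> and over \<open>[3 * 2^(h-1), 2^(h+1))\<close>. Replacing each exponent by its odd part, the
  numbers with leading bits 11 and at most \<open>h\<close> bits cancel, as does \<open>T(1)\<close>. The surviving odd
  exponents lie in pairwise distinct cyclotomic cosets of full size \<open>m\<close>, so the sequence is a sum of
  distinct geometric progressions, and a Vandermonde argument shows that its minimal polynomial is
  the product of the corresponding linear factors. The odd exponents in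
  \<open>[3 * 2^(h-1), 2^(h+1))\<close> form an arithmetic progression of \<open>2^(h-2)\<close> zeros of the code with
  difference 2, which is coprime to the length, so the BCH bound gives the lower bound on the
  distance. The upper bound is the weight of the generator polynomial.
\<close>

text \<open>Vandermonde argument in dual form: the equations are combined with the coefficients of
  the polynomial \<open>p\<close> that vanishes at every node except \<open>x i\<close>. Its degree
  \<open>card S - 1\<close> stays below \<open>N\<close>.\<close>

lemma power_sums_zero_imp_zero:
  fixes x c :: "'b \<Rightarrow> 'a::field"
  assumes fin: "finite S" and inj: "inj_on x S" and le: "card S \<le> N"
    and zero: "\<And>k. k < N \<Longrightarrow> (\<Sum>i\<in>S. c i * x i ^ k) = 0" and i: "i \<in> S"
  shows "c i = 0"
proof -
  define p where "p = (\<Prod>j\<in>S - {i}. [:- x j, 1:])"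
  have pos: "card S > 0" using fin i card_gt_0_iff by blast
  have "degree p = (\<Sum>j\<in>S - {i}. degree [:- x j, 1:])"
    unfolding p_def by (rule degree_prod_eq_sum_degree) auto
  also have "\<dots> = card S - 1" using fin i by simp
  finally have deg: "degree p < N" using le pos by simp
  have "(\<Sum>j\<in>S. c j * poly p (x j)) = (\<Sum>k\<le>degree p. coeff p k * (\<Sum>j\<in>S. c j * x j ^ k))"
    unfolding poly_altdef sum_distrib_left by (subst sum.swap) (simp add: algebra_simps)
  also have "\<dots> = 0" using zero deg by (intro sum.neutral) auto
  finally have "(\<Sum>j\<in>S. c j * poly p (x j)) = 0" .
  moreover have "poly p (x j) = 0" if "j \<in> S - {i}" for j
    unfolding p_def poly_prod using that fin by (intro prod_zero) auto
  ultimately have "c i * poly p (x i) = 0"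
    using fin i by (simp add: sum.remove[of S i])
  moreover have "poly p (x i) \<noteq> 0"
    unfolding p_def poly_prod using fin i inj by (auto simp: inj_on_def)
  ultimately show ?thesis by simp
qed

subsection \<open>Polynomials with prescribed simple roots\<close>

definition root_poly :: "'a::field set \<Rightarrow> 'a poly" where
  "root_poly R = (\<Prod>r\<in>R. [:- r, 1:])"

lemma degree_root_poly: "finite R \<Longrightarrow> degree (root_poly R) = card R"
  unfolding root_poly_def by (subst degree_prod_eq_sum_degree) auto

lemma lead_coeff_root_poly [simp]: "lead_coeff (root_poly R) = 1"
  unfolding root_poly_def by (simp add: lead_coeff_prod)

lemma root_poly_nonzero [simp]: "root_poly R \<noteq> 0"
  using lead_coeff_root_poly[of R] by force

lemma poly_root_poly_eq_0_iff: "finite R \<Longrightarrow> poly (root_poly R) x = 0 \<longleftrightarrow> x \<in> R"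
  unfolding root_poly_def by (auto simp: poly_prod)

lemma root_poly_dvd:
  assumes "finite R" "\<And>r. r \<in> R \<Longrightarrow> poly q r = 0"
  shows "root_poly R dvd q"
  using assms
proof (induction R arbitrary: q rule: finite_induct)
  case empty
  then show ?case by (simp add: root_poly_def)
next
  case (insert a R)
  from insert.prems[of a] obtain u where u: "q = [:- a, 1:] * u"
    by (auto simp: poly_eq_0_iff_dvd)
  have "poly u r = 0" if "r \<in> R" for r
    using insert.prems[of r] insert.hyps(2) that unfolding u by auto
  then have "root_poly R dvd u" by (rule insert.IH)
  then show ?case
    using insert.hyps unfolding u root_poly_def by (simp add: mult_dvd_mono del: mult_pCons_left)
qed

text \<open>Supplies uniqueness for the \<open>THE\<close> definitions: divisibility together with
  minimality of the degree forces equality.\<close>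

lemma monic_dvd_same_degree_eq:
  fixes p q :: "'a::field poly"
  assumes "p dvd q" "lead_coeff p = 1" "lead_coeff q = 1" "degree q \<le> degree p"
  shows "q = p"
proof -
  obtain u where u: "q = p * u" using assms(1) by blast
  have nz: "p \<noteq> 0" "u \<noteq> 0" using assms(2,3) u by auto
  then have "degree u = 0" using assms(4) u by (simp add: degree_mult_eq)
  then obtain c where c: "u = [:c:]" by (rule degree_eq_zeroE)
  have "lead_coeff u = 1" using assms(2,3) unfolding u by (simp add: lead_coeff_mult)
  then show ?thesis using u c by (simp add: one_pCons[symmetric])
qed

subsection \<open>Binary polynomials in characteristic two\<close>

text \<open>Coefficientwise Frobenius. Binary polynomials are exactly its fixed points, and in
  characteristic two it respects sums and products, which yields the closure properties
  below.\<close>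

definition frob_poly :: "'a::field poly \<Rightarrow> 'a poly" where
  "frob_poly = map_poly (\<lambda>x. x\<^sup>2)"

lemma coeff_frob_poly: "coeff (frob_poly p) n = (coeff p n)\<^sup>2"
  unfolding frob_poly_def by (simp add: coeff_map_poly)

lemma binary_iff: "binary (x::'a::field) \<longleftrightarrow> x\<^sup>2 = x"
proof -
  have "x\<^sup>2 = x \<longleftrightarrow> x * (x - 1) = 0" by (simp add: algebra_simps power2_eq_square)
  then show ?thesis by (simp add: binary_def)
qed

lemma binary_poly_iff: "binary_poly p \<longleftrightarrow> frob_poly p = p"
  by (auto simp: binary_poly_def binary_iff poly_eq_iff coeff_frob_poly)

lemma degree_frob_poly: "degree (frob_poly p) = degree p"
  unfolding frob_poly_def by (rule degree_map_poly) simp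

context
  assumes two: "(2::'a::field) = 0"
begin

lemma square_add: "(x + y)\<^sup>2 = x\<^sup>2 + (y::'a)\<^sup>2"
  using two by (simp add: power2_sum)

lemma add_self: "x + x = (0::'a)"
  using two by (metis mult_2 mult_zero_left)

lemma neg_eq: "- x = (x::'a)"
  using add_self by (metis add_eq_0_iff)

lemma square_sum: "(sum f A)\<^sup>2 = (\<Sum>i\<in>A. (f i :: 'a)\<^sup>2)"
  by (induction A rule: infinite_finite_induct) (auto simp: square_add)

lemma square_inj: "x\<^sup>2 = y\<^sup>2 \<longleftrightarrow> x = (y::'a)"
  by (simp add: power2_eq_iff neg_eq)

lemma power_two_power_add: "(x + y) ^ 2 ^ k = x ^ 2 ^ k + (y::'a) ^ 2 ^ k"
  by (induction k) (auto simp: power_mult square_add mult.commute[of 2])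

lemma power_two_power_inj: "x ^ 2 ^ k = y ^ 2 ^ k \<longleftrightarrow> x = (y::'a)"
  by (induction k) (auto simp: power_mult square_inj mult.commute[of 2])

lemma frob_poly_mult: "frob_poly (p * q) = frob_poly p * frob_poly (q::'a poly)"
  by (rule poly_eqI) (simp add: coeff_frob_poly coeff_mult square_sum power_mult_distrib)

lemma frob_poly_add: "frob_poly (p + q) = frob_poly p + frob_poly (q::'a poly)"
  by (rule poly_eqI) (simp add: coeff_frob_poly square_add)

lemma frob_poly_root_poly:
  assumes "finite R"
  shows "frob_poly (root_poly R) = root_poly ((\<lambda>r. r\<^sup>2) ` (R::'a set))"
proof -
  have "frob_poly (\<Prod>r\<in>R. [:- r, 1:]) = (\<Prod>r\<in>R. [:- r\<^sup>2, 1:])"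
    using assms
  proof (induction R rule: finite_induct)
    case empty
    show ?case by (rule poly_eqI) (simp add: coeff_frob_poly coeff_1)
  next
    case (insert a R)
    have "frob_poly [:- a, 1:] = [:- a\<^sup>2, 1:]"
      by (rule poly_eqI) (simp add: coeff_frob_poly coeff_pCons neg_eq split: nat.splits)
    then show ?case using insert by (simp add: frob_poly_mult del: mult_pCons_left)
  qed
  then show ?thesis
    unfolding root_poly_def by (subst prod.reindex) (auto simp: inj_on_def square_inj)
qed

text \<open>Squaring is injective in characteristic two, so a finite set closed under it is
  permuted, and Frobenius only permutes the linear factors.\<close>

lemma binary_root_poly:
  assumes "finite R" "\<And>r. r \<in> R \<Longrightarrow> r\<^sup>2 \<in> (R::'a set)"
  shows "binary_poly (root_poly R)"
proof -
  have "(\<lambda>r. r\<^sup>2) ` R = R"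
    using assms by (intro endo_inj_surj) (auto simp: inj_on_def square_inj)
  then show ?thesis using assms(1) by (simp add: binary_poly_iff frob_poly_root_poly)
qed

text \<open>Frobenius turns the division of \<open>p\<close> by \<open>q\<close> into another one
  whose remainder has the same degree, so uniqueness of the remainder makes it a fixed
  point.\<close>

lemma binary_poly_mod:
  assumes "binary_poly p" "binary_poly (q::'a poly)"
  shows "binary_poly (p mod q)"
proof (cases "q = 0")
  case False
  have "p = frob_poly (p div q * q + p mod q)"
    using assms(1) by (simp add: binary_poly_iff)
  then have eq: "p = frob_poly (p div q) * q + frob_poly (p mod q)"
    using assms(2) by (simp only: frob_poly_add frob_poly_mult binary_poly_iff)
  have "p mod q = frob_poly (p mod q) mod q"
    by (subst eq) simp
  also have "\<dots> = frob_poly (p mod q)"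
  proof (cases "p mod q = 0")
    case True
    then show ?thesis by (simp add: frob_poly_def)
  next
    case nz: False
    then show ?thesis
      using degree_mod_less[OF False, of p] by (intro mod_poly_less) (simp add: degree_frob_poly)
  qed
  finally show ?thesis by (simp add: binary_poly_iff)
qed (use assms in simp)

lemma poly_binary_square:
  assumes "binary_poly (q::'a poly)"
  shows "poly q (x\<^sup>2) = (poly q x)\<^sup>2"
proof -
  have "(coeff q i)\<^sup>2 = coeff q i" for i
    using assms by (auto simp: binary_poly_def binary_iff)
  then show ?thesis
    by (simp add: poly_altdef square_sum power_mult_distrib power_mult[symmetric] mult.commute)
qed

lemma poly_binary_conjugate:
  assumes "binary_poly (q::'a poly)" "poly q x = 0"
  shows "poly q (x ^ 2 ^ k) = 0"
proof (induction k)
  case (Suc k)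
  then show ?case
    using poly_binary_square[OF assms(1), of "x ^ 2 ^ k"]
    by (simp add: power_mult[symmetric] mult.commute)
qed (use assms in simp)

text \<open>A binary polynomial vanishing at \<open>b\<close> vanishes at all conjugates, and the
  product of their linear factors is itself binary. The roots form a set, so repeated conjugates
  contribute a single factor.\<close>

lemma min_poly_F2_eq:
  fixes b :: 'a
  assumes per: "b ^ 2 ^ m = b" and m: "m > 0"
  shows "min_poly_F2 b = root_poly ((\<lambda>k. b ^ 2 ^ k) ` {..<m})"
proof -
  let ?R = "(\<lambda>k. b ^ 2 ^ k) ` {..<m}"
  have "r\<^sup>2 \<in> ?R" if r: "r \<in> ?R" for r
  proof -
    obtain k where k: "k < m" "r = b ^ 2 ^ k" using r by auto
    have r2: "r\<^sup>2 = b ^ 2 ^ Suc k" using k by (simp add: power_mult[symmetric] mult.commute)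
    show ?thesis
    proof (cases "Suc k = m")
      case True
      then have "r\<^sup>2 = b ^ 2 ^ 0" using r2 per by simp
      then show ?thesis using m by blast
    next
      case False
      then show ?thesis using r2 k by (intro image_eqI[of _ _ "Suc k"]) auto
    qed
  qed
  then have bin: "binary_poly (root_poly ?R)" by (intro binary_root_poly) auto
  have "b ^ 2 ^ 0 \<in> ?R" using m by blast
  then have root: "poly (root_poly ?R) b = 0" by (simp add: poly_root_poly_eq_0_iff)
  have dvd: "root_poly ?R dvd q" if "binary_poly q" "poly q b = 0" for q
    using that poly_binary_conjugate by (intro root_poly_dvd) auto
  have "is_min_poly_F2 b (root_poly ?R)"
    unfolding is_min_poly_F2_def using bin root dvd by (auto intro: dvd_imp_degree_le)
  moreover have "p = root_poly ?R" if "is_min_poly_F2 b p" for p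
    using that bin root unfolding is_min_poly_F2_def
    by (intro monic_dvd_same_degree_eq dvd) auto
  ultimately show ?thesis unfolding min_poly_F2_def by (rule the_equality)
qed

end

subsection \<open>Sequences that are sums of geometric progressions\<close>

text \<open>The recurrence reads \<open>s\<close> backwards, so applying it to the progression with
  ratio \<open>inverse r\<close> multiplies that progression by \<open>poly q r\<close>.
  Independence of distinct progressions then forces every such factor to vanish.\<close>

lemma lin_rec_power_sum_iff:
  fixes R :: "'a::field set"
  assumes fin: "finite R" and nz: "0 \<notin> R" and s: "\<And>t. s t = (\<Sum>r\<in>R. inverse r ^ t)"
  shows "lin_rec q s \<longleftrightarrow> (\<forall>r\<in>R. poly q r = 0)"
proof -
  have eq: "(\<Sum>k\<le>degree q. coeff q k * s (i - k)) = (\<Sum>r\<in>R. inverse r ^ i * poly q r)"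
    if i: "i \<ge> degree q" for i
  proof -
    have "(\<Sum>k\<le>degree q. coeff q k * s (i - k)) =
        (\<Sum>r\<in>R. \<Sum>k\<le>degree q. coeff q k * inverse r ^ (i - k))"
      unfolding s sum_distrib_left by (rule sum.swap)
    also have "\<dots> = (\<Sum>r\<in>R. \<Sum>k\<le>degree q. inverse r ^ i * (coeff q k * r ^ k))"
    proof (intro sum.cong refl)
      fix r k assume "r \<in> R" "k \<in> {..degree q}"
      then have "r \<noteq> 0" "k \<le> i" using nz i by auto
      then show "coeff q k * inverse r ^ (i - k) = inverse r ^ i * (coeff q k * r ^ k)"
        by (simp add: power_diff field_simps)
    qed
    finally show ?thesis by (simp add: poly_altdef sum_distrib_left)
  qed
  show ?thesis
  proof
    assume rec: "lin_rec q s"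
    \<comment> \<open>Only indices from \<open>degree q\<close> on are available; the offset is
      absorbed into the weights \<open>inverse r ^ degree q\<close>.\<close>
    have zero: "(\<Sum>r\<in>R. inverse r ^ degree q * poly q r * inverse r ^ k) = 0" for k
    proof -
      have "(\<Sum>r\<in>R. inverse r ^ (degree q + k) * poly q r) = 0"
        using rec eq[of "degree q + k"] unfolding lin_rec_def by simp
      then show ?thesis by (simp add: power_add mult_ac)
    qed
    show "\<forall>r\<in>R. poly q r = 0"
    proof
      fix r assume r: "r \<in> R"
      have "inverse r ^ degree q * poly q r = 0"
        using power_sums_zero_imp_zero[where c = "\<lambda>r. inverse r ^ degree q * poly q r"
            and x = inverse and N = "card R", OF fin _ _ zero r]
        by (simp add: inj_on_def)
      then show "poly q r = 0" using r nz by auto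
    qed
  next
    assume "\<forall>r\<in>R. poly q r = 0"
    then show "lin_rec q s" unfolding lin_rec_def by (auto simp: eq)
  qed
qed

lemma seq_min_poly_power_sum:
  fixes R :: "'a::field set"
  assumes fin: "finite R" and nz: "0 \<notin> R" and s: "\<And>t. s t = (\<Sum>r\<in>R. inverse r ^ t)"
    and bin: "binary_poly (root_poly R)"
  shows "seq_min_poly s = root_poly R"
proof -
  note rec = lin_rec_power_sum_iff[OF fin nz s]
  have "poly (root_poly R) 0 \<noteq> 0" using fin nz by (simp add: poly_root_poly_eq_0_iff)
  then have c0: "coeff (root_poly R) 0 = 1"
    using bin unfolding binary_poly_def binary_def by (auto simp: poly_0_coeff_0)
  have lr: "lin_rec (root_poly R) s" using fin by (simp add: rec poly_root_poly_eq_0_iff)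
  have dvd: "root_poly R dvd q" if "lin_rec q s" for q
    using that fin by (intro root_poly_dvd) (auto simp: rec)
  have "is_seq_min_poly s (root_poly R)"
    unfolding is_seq_min_poly_def
    using c0 bin lr dvd by (auto intro!: dvd_imp_degree_le)
  moreover have "q = root_poly R" if q: "is_seq_min_poly s q" for q
  proof (rule monic_dvd_same_degree_eq)
    \<comment> \<open>The polynomial is normalised at its constant term, but a nonzero binary
      leading coefficient is 1 as well.\<close>
    have "q \<noteq> 0" using q unfolding is_seq_min_poly_def by auto
    then show "lead_coeff q = 1"
      using q unfolding is_seq_min_poly_def binary_poly_def binary_def
      by (metis leading_coeff_0_iff)
    show "root_poly R dvd q" "degree q \<le> degree (root_poly R)"
      using q dvd c0 bin lr unfolding is_seq_min_poly_def by auto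
  qed simp
  ultimately show ?thesis unfolding seq_min_poly_def by (rule the_equality)
qed

subsection \<open>Finite fields of order a power of two\<close>

text \<open>Translation by 1 permutes the field and so preserves the sum of all elements; hence the
  number of elements is zero in the field.\<close>

lemma two_eq_zero_if_card:
  assumes "card (UNIV :: 'a::{finite,field} set) = 2 ^ m"
  shows "(2::'a) = 0"
proof -
  have "(\<Sum>x\<in>UNIV. x + 1) = (\<Sum>x\<in>UNIV. x :: 'a)"
    by (rule sum.reindex_bij_witness[of _ "\<lambda>x. x - 1" "\<lambda>x. x + 1"]) auto
  then have "of_nat (card (UNIV :: 'a set)) = (0::'a)" by (simp add: sum.distrib)
  then show ?thesis unfolding assms by simp
qed

text \<open>Multiplication by \<open>x\<close> permutes the nonzero elements, so it preserves their
  product.\<close>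

lemma power_card_minus_one:
  fixes x :: "'a::{finite,field}"
  assumes "x \<noteq> 0"
  shows "x ^ (card (UNIV :: 'a set) - 1) = 1"
proof -
  let ?U = "UNIV - {0::'a}"
  have "(\<Prod>y\<in>?U. x * y) = \<Prod>?U"
    using assms by (intro prod.reindex_bij_witness[of _ "\<lambda>y. y / x" "\<lambda>y. x * y"]) auto
  then have "x ^ card ?U * \<Prod>?U = \<Prod>?U" by (simp add: prod.distrib)
  moreover have "\<Prod>?U \<noteq> 0" by simp
  ultimately have "x ^ card ?U = 1" by simp
  then show ?thesis by (simp add: card_Diff_singleton)
qed

lemma power_card:
  fixes x :: "'a::{finite,field}"
  shows "x ^ card (UNIV :: 'a set) = x"
proof (cases "x = 0")
  case False
  have "card (UNIV :: 'a set) = Suc (card (UNIV :: 'a set) - 1)" by (simp add: card_gt_0_iff)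
  then have "x ^ card (UNIV :: 'a set) = x * x ^ (card (UNIV :: 'a set) - 1)"
    by (metis power_Suc)
  then show ?thesis using power_card_minus_one[OF False] by simp
qed (simp add: card_gt_0_iff)

text \<open>Exponents below the group order already reach all nonzero elements, and a surjection
  between finite sets of equal size is injective.\<close>

lemma primitive_power_inj:
  fixes a :: "'a::{finite,field}"
  assumes prim: "primitive a"
  shows "inj_on (\<lambda>k. a ^ k) {..<card (UNIV :: 'a set) - 1}"
proof -
  let ?v = "card (UNIV :: 'a set) - 1"
  have a: "a \<noteq> 0" using prim by (simp add: primitive_def)
  have "card {0, 1 :: 'a} \<le> card (UNIV :: 'a set)" by (intro card_mono) auto
  then have v: "?v > 0" by simp
  have "(\<lambda>k. a ^ k) ` {..<?v} = UNIV - {0}"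
  proof (intro equalityI subsetI)
    fix x assume "x \<in> UNIV - {0 :: 'a}"
    then obtain k where k: "x = a ^ k" using prim unfolding primitive_def by auto
    have "a ^ k = a ^ (?v * (k div ?v) + k mod ?v)" by simp
    also have "\<dots> = a ^ (k mod ?v)"
      unfolding power_add power_mult power_card_minus_one[OF a] by simp
    finally show "x \<in> (\<lambda>k. a ^ k) ` {..<?v}" using k v by auto
  qed (use a in auto)
  then have "card ((\<lambda>k. a ^ k) ` {..<?v}) = card {..<?v}" by (simp add: card_Diff_singleton)
  then show ?thesis by (intro eq_card_imp_inj_on) auto
qed

lemma root_poly_Un:
  "finite A \<Longrightarrow> finite B \<Longrightarrow> A \<inter> B = {} \<Longrightarrow> root_poly (A \<union> B) = root_poly A * root_poly B"
  unfolding root_poly_def by (rule prod.union_disjoint)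

lemma root_poly_nonzero_elements:
  "root_poly (UNIV - {0::'a::{finite,field}}) = monom 1 (card (UNIV :: 'a set) - 1) - 1"
proof -
  let ?v = "card (UNIV :: 'a set) - 1"
  let ?M = "monom 1 ?v - 1 :: 'a poly"
  have "card {0, 1 :: 'a} \<le> card (UNIV :: 'a set)" by (intro card_mono) auto
  then have v: "?v > 0" by simp
  have "coeff ?M ?v = 1" "degree ?M \<le> ?v"
    using v by (auto simp: coeff_1 intro!: degree_diff_le degree_monom_le)
  moreover from this have "degree ?M = ?v" by (metis le_antisym le_degree zero_neq_one)
  ultimately have "?M = root_poly (UNIV - {0})"
    using power_card_minus_one[where 'a = 'a]
    by (intro monic_dvd_same_degree_eq root_poly_dvd lead_coeff_root_poly)
      (auto simp: poly_monom degree_root_poly card_Diff_singleton)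
  then show ?thesis by simp
qed

subsection \<open>Cyclic codes of length one less than the field order\<close>

text \<open>Bounding coefficient indices rather than the degree keeps the zero polynomial in the
  count, also for \<open>n = 0\<close>.\<close>

lemma card_binary_polys:
  "card {p::'a::field poly. binary_poly p \<and> (\<forall>i\<ge>n. coeff p i = 0)} = 2 ^ n"
  (is "card (?S n) = _")
proof (induction n)
  case 0
  have "?S 0 = {0}" by (auto simp: poly_eq_iff binary_poly_def binary_def)
  then show ?case by simp
next
  case (Suc n)
  have "?S (Suc n) = (\<lambda>(a, p). pCons a p) ` ({0, 1} \<times> ?S n)"
  proof (intro equalityI subsetI)
    fix q assume q: "q \<in> ?S (Suc n)"
    obtain a p where ap: "q = pCons a p" by (cases q) auto
    have "binary a" using q ap unfolding binary_poly_def by (auto dest: spec[of _ 0])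
    moreover have "binary (coeff p i)" for i
      using q ap unfolding binary_poly_def by (auto dest: spec[of _ "Suc i"])
    moreover have "coeff p i = 0" if "i \<ge> n" for i
      using q ap that by (auto dest: spec[of _ "Suc i"])
    ultimately show "q \<in> (\<lambda>(a, p). pCons a p) ` ({0, 1} \<times> ?S n)"
      unfolding ap by (auto simp: binary_def binary_poly_def intro!: image_eqI[of _ _ "(a, p)"])
  qed (auto simp: binary_poly_def binary_def coeff_pCons split: nat.splits)
  then have "card (?S (Suc n)) = card ({0, 1 :: 'a} \<times> ?S n)"
    by (simp add: card_image inj_on_def)
  then show ?case using Suc by (simp add: card_cartesian_product)
qed

text \<open>The modulus factors into the generator and the check polynomial
  \<open>root_poly K\<close>. Reducing a multiple of the generator thus only reduces the multiplier
  modulo the check polynomial.\<close>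

lemma cyclic_code_root_poly:
  fixes R :: "'a::{finite,field} set"
  assumes two: "(2::'a) = 0" and nz: "0 \<notin> R" and sq: "(\<lambda>r. r\<^sup>2) ` R \<subseteq> R"
    and v: "v = card (UNIV :: 'a set) - 1"
  shows "cyclic_code v (root_poly R) =
    (\<lambda>a. root_poly R * a) ` {a. binary_poly a \<and> (\<forall>i\<ge>v - card R. coeff a i = 0)}"
proof -
  define K where "K = UNIV - {0} - R"
  have "root_poly R * root_poly K = root_poly (R \<union> K)"
    unfolding K_def by (rule root_poly_Un[symmetric]) auto
  also have "R \<union> K = UNIV - {0}" using nz by (auto simp: K_def)
  finally have M: "monom 1 v - 1 = root_poly R * root_poly K"
    by (simp add: root_poly_nonzero_elements v)
  have cK: "card K = v - card R"
    unfolding K_def v using nz by (subst card_Diff_subset) (auto simp: card_Diff_singleton)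
  \<comment> \<open>Surjectivity of squaring on \<open>R\<close> keeps squares of elements of
    \<open>K\<close> out of \<open>R\<close>; so the check polynomial is binary, and so are
    remainders modulo it.\<close>
  have img: "(\<lambda>r. r\<^sup>2) ` R = R"
    using sq by (intro endo_inj_surj) (auto simp: inj_on_def square_inj[OF two])
  have "binary_poly (root_poly K)"
  proof (rule binary_root_poly[OF two])
    fix r assume r: "r \<in> K"
    have "r\<^sup>2 \<notin> R"
    proof
      assume "r\<^sup>2 \<in> R"
      then have "r\<^sup>2 \<in> (\<lambda>r. r\<^sup>2) ` R" unfolding img .
      then obtain r' where "r' \<in> R" "r\<^sup>2 = r'\<^sup>2" by blast
      then show False using r by (auto simp: square_inj[OF two] K_def)
    qed
    then show "r\<^sup>2 \<in> K" using r by (auto simp: K_def)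
  qed simp
  note bK = this
  have mod: "(a * root_poly R) mod (monom 1 v - 1) = root_poly R * (a mod root_poly K)" for a
    unfolding M by (metis mod_mult_mult1 mult.commute)
  have small: "a mod root_poly K = a \<longleftrightarrow> (\<forall>i\<ge>v - card R. coeff a i = 0)" for a
  proof
    assume "a mod root_poly K = a"
    then have "a = 0 \<or> degree a < card K"
      using degree_mod_less[of "root_poly K" a] by (simp add: degree_root_poly)
    then show "\<forall>i\<ge>v - card R. coeff a i = 0" using cK by (auto simp: coeff_eq_0)
  next
    assume "\<forall>i\<ge>v - card R. coeff a i = 0"
    then have "a = 0 \<or> degree a < card K"
      using cK by (metis leading_coeff_0_iff not_le)
    then show "a mod root_poly K = a" by (auto simp: mod_poly_less degree_root_poly)
  qed
  show ?thesis
  proof (intro equalityI subsetI)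
    fix c assume "c \<in> cyclic_code v (root_poly R)"
    then obtain a where "binary_poly a" "c = root_poly R * (a mod root_poly K)"
      by (auto simp: cyclic_code_def mod)
    then show "c \<in> (\<lambda>a. root_poly R * a) ` {a. binary_poly a \<and> (\<forall>i\<ge>v - card R. coeff a i = 0)}"
      using binary_poly_mod[OF two _ bK, of a] by (auto simp: small[symmetric])
  next
    fix c assume "c \<in> (\<lambda>a. root_poly R * a) ` {a. binary_poly a \<and> (\<forall>i\<ge>v - card R. coeff a i = 0)}"
    then show "c \<in> cyclic_code v (root_poly R)"
      by (auto simp: cyclic_code_def mod small[symmetric]) metis
  qed
qed

lemma card_cyclic_code_root_poly:
  fixes R :: "'a::{finite,field} set"
  assumes "(2::'a) = 0" "0 \<notin> R" "(\<lambda>r. r\<^sup>2) ` R \<subseteq> R" "v = card (UNIV :: 'a set) - 1"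
  shows "card (cyclic_code v (root_poly R)) = 2 ^ (v - card R)"
  unfolding cyclic_code_root_poly[OF assms]
  by (subst card_image) (auto simp: inj_on_def card_binary_polys)

lemma generator_in_cyclic_code:
  fixes R :: "'a::{finite,field} set"
  assumes "(2::'a) = 0" "0 \<notin> R" "(\<lambda>r. r\<^sup>2) ` R \<subseteq> R" "v = card (UNIV :: 'a set) - 1"
    and "card R < v"
  shows "root_poly R \<in> cyclic_code v (root_poly R)" "0 \<in> cyclic_code v (root_poly R)"
proof -
  note code = cyclic_code_root_poly[OF assms(1-4)]
  have "root_poly R * 1 \<in> cyclic_code v (root_poly R)" unfolding code using assms(5)
    by (intro imageI) (auto simp: binary_poly_def binary_def coeff_1)
  then show "root_poly R \<in> cyclic_code v (root_poly R)" by simp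
  have "root_poly R * 0 \<in> cyclic_code v (root_poly R)" unfolding code
    by (intro imageI) (auto simp: binary_poly_def binary_def)
  then show "0 \<in> cyclic_code v (root_poly R)" by simp
qed

lemma finite_hamming_dists: "finite {hamming_dist v c c' |c c'. P c c'}"
proof (rule finite_subset)
  show "{hamming_dist v c c' |c c'. P c c'} \<subseteq> {..card {..<v}}"
    unfolding hamming_dist_def by (auto intro!: card_mono simp del: card_lessThan)
qed simp

text \<open>The generator is compared with the zero word; a polynomial of degree
  \<open>card R\<close> has at most \<open>card R + 1\<close> nonzero coefficients.\<close>

lemma min_dist_cyclic_code_le:
  fixes R :: "'a::{finite,field} set"
  assumes "(2::'a) = 0" "0 \<notin> R" "(\<lambda>r. r\<^sup>2) ` R \<subseteq> R" "v = card (UNIV :: 'a set) - 1"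
    and "card R < v"
  shows "min_dist v (cyclic_code v (root_poly R)) \<le> 1 + card R"
proof -
  have "min_dist v (cyclic_code v (root_poly R)) \<le> hamming_dist v (root_poly R) 0"
    unfolding min_dist_def using generator_in_cyclic_code[OF assms] root_poly_nonzero[of R]
    by (intro Min_le finite_hamming_dists) blast
  also have "\<dots> \<le> card {..degree (root_poly R)}"
    unfolding hamming_dist_def by (intro card_mono) (auto intro: le_degree)
  finally show ?thesis by (simp add: degree_root_poly)
qed

text \<open>If two codewords differed in at most \<open>N\<close> positions, the \<open>N\<close>
  roots in geometric progression would give a Vandermonde system forcing their difference to be
  zero.\<close>

lemma BCH_bound:
  fixes R :: "'a::{finite,field} set"
  assumes "(2::'a) = 0" "0 \<notin> R" "(\<lambda>r. r\<^sup>2) ` R \<subseteq> R" "v = card (UNIV :: 'a set) - 1"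
    and "card R < v"
    and inj: "inj_on (\<lambda>i. \<gamma> ^ i) {..<v}" and b: "b \<noteq> 0"
    and roots: "\<And>k. k < N \<Longrightarrow> b * \<gamma> ^ k \<in> R"
  shows "N + 1 \<le> min_dist v (cyclic_code v (root_poly R))"
proof -
  note code = cyclic_code_root_poly[OF assms(1-4)]
  let ?C = "cyclic_code v (root_poly R)" and ?g = "root_poly R"
  let ?D = "{hamming_dist v c c' |c c'. c \<in> ?C \<and> c' \<in> ?C \<and> c \<noteq> c'}"
  have "?D \<noteq> {}"
    using generator_in_cyclic_code[OF assms(1-5)] root_poly_nonzero[of R] by blast
  moreover have "N < hamming_dist v c c'" if c: "c \<in> ?C" "c' \<in> ?C" "c \<noteq> c'" for c c'
  proof (rule ccontr)
    assume not: "\<not> N < hamming_dist v c c'"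
    define d where "d = c - c'"
    define S where "S = {i. i < v \<and> coeff c i \<noteq> coeff c' i}"
    have S: "finite S" "card S \<le> N" "S \<subseteq> {..<v}" using not by (auto simp: S_def hamming_dist_def)
    obtain a a' where a: "c = ?g * a" "c' = ?g * a'"
      "\<forall>i\<ge>v - card R. coeff a i = 0" "\<forall>i\<ge>v - card R. coeff a' i = 0"
      using c unfolding code by auto
    have d: "d = ?g * (a - a')" unfolding d_def a by (simp add: algebra_simps)
    have "a \<noteq> a'" using c a by auto
    then have "degree (a - a') < v - card R"
      using a(3,4) by (metis coeff_diff diff_zero leading_coeff_0_iff not_le right_minus_eq)
    then have degd: "degree d < v"
      unfolding d using \<open>a \<noteq> a'\<close> by (simp add: degree_mult_eq degree_root_poly)
    have "d \<noteq> 0" using c d_def by simp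
    have dS: "coeff d i = 0" if "i \<notin> S" for i
      using that degd coeff_eq_0[of d i] by (cases "i < v") (auto simp: S_def d_def)
    have poly_d: "poly d x = (\<Sum>i\<in>S. coeff d i * x ^ i)" for x
    proof -
      have "poly d x = (\<Sum>i<v. coeff d i * x ^ i)"
        unfolding poly_altdef using degd by (intro sum.mono_neutral_left) (auto simp: coeff_eq_0)
      also have "\<dots> = (\<Sum>i\<in>S. coeff d i * x ^ i)"
        using S dS by (intro sum.mono_neutral_right) auto
      finally show ?thesis .
    qed
    \<comment> \<open>Exponents are exchanged: the positions in \<open>S\<close> become the nodes
      \<open>\<gamma> ^ i\<close>, and the successive roots become the successive power
      sums.\<close>
    have zero: "(\<Sum>i\<in>S. (coeff d i * b ^ i) * (\<gamma> ^ i) ^ k) = 0" if "k < N" for k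
    proof -
      have "poly d (b * \<gamma> ^ k) = 0"
        unfolding d using roots[OF that] by (simp add: poly_root_poly_eq_0_iff)
      moreover have "poly d (b * \<gamma> ^ k) = (\<Sum>i\<in>S. (coeff d i * b ^ i) * (\<gamma> ^ i) ^ k)"
        unfolding poly_d
        by (intro sum.cong refl) (simp add: power_mult_distrib power_mult[symmetric] mult_ac)
      ultimately show ?thesis by simp
    qed
    have "coeff d i = 0" for i
    proof (cases "i \<in> S")
      case True
      have "coeff d i * b ^ i = 0"
        by (rule power_sums_zero_imp_zero[where c = "\<lambda>i. coeff d i * b ^ i",
              OF S(1) inj_on_subset[OF inj S(3)] S(2) zero True])
      then show ?thesis using b by simp
    qed (rule dS)
    then have "d = 0" by (simp add: poly_eq_iff)
    then show False using \<open>d \<noteq> 0\<close> by simp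
  qed
  ultimately show ?thesis
    unfolding min_dist_def by (subst Min_ge_iff) (fastforce simp: finite_hamming_dists)+
qed

subsection \<open>Cyclotomic coset leaders\<close>

text \<open>One halving step; iterating it replaces every exponent by its odd part.\<close>

lemma sum_even_odd_split:
  fixes T :: "nat \<Rightarrow> 'b::comm_monoid_add"
  assumes "\<And>n. T (2 * n) = T n"
  shows "sum T {2 * a..<2 * b} = sum T {a..<b} + sum T {i \<in> {2 * a..<2 * b}. odd i}"
proof -
  have "{2 * a..<2 * b} = (\<lambda>n. 2 * n) ` {a..<b} \<union> {i \<in> {2 * a..<2 * b}. odd i}"
    by (auto elim!: evenE)
  then have "sum T {2 * a..<2 * b} =
      sum T ((\<lambda>n. 2 * n) ` {a..<b} \<union> {i \<in> {2 * a..<2 * b}. odd i})" by (rule arg_cong)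
  also have "\<dots> = sum T ((\<lambda>n. 2 * n) ` {a..<b}) + sum T {i \<in> {2 * a..<2 * b}. odd i}"
    by (rule sum.union_disjoint) auto
  also have "sum T ((\<lambda>n. 2 * n) ` {a..<b}) = sum T {a..<b}"
    by (subst sum.reindex) (auto simp: inj_on_def assms)
  finally show ?thesis .
qed

section \<open>Odd exponents and sums over dyadic intervals\<close>

lemma Gamma_iff: "i \<in> Gamma t \<longleftrightarrow> odd i \<and> i < 2 ^ t"
proof -
  have "i \<le> 2 ^ t - 1 \<longleftrightarrow> i < 2 ^ t" 
    using zero_less_power[of "2::nat" t] by linarith
  then show ?thesis unfolding Gamma_def by (auto elim: oddE)
qed

lemma finite_Gamma: "finite (Gamma t)"
  by (rule finite_subset[of _ "{..<2 ^ t}"]) (auto simp: Gamma_iff)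

lemma card_Gamma: "card (Gamma (Suc t)) = 2 ^ t"
proof -
  have "Gamma (Suc t) = (\<lambda>k. 2 * k + 1) ` {..<2 ^ t}"
    by (auto simp: Gamma_iff elim!: oddE)
  then show ?thesis by (simp add: card_image inj_on_def)
qed

text \<open>The interval holds the numbers with \<open>k + 2\<close> bits and leading bits 10.
  Halving the even ones gives the same shape with one bit less, down to the number 2, which
  contributes \<open>T 1\<close>.\<close>

lemma sum_leading_bits_10:
  fixes T :: "nat \<Rightarrow> 'b::comm_monoid_add"
  assumes T: "\<And>n. T (2 * n) = T n"
  shows "sum T {2 * 2 ^ k..<3 * 2 ^ k} = T 1 + (\<Sum>j\<in>{1..k}. \<Sum>i\<in>Gamma j. T (i + 2 ^ (j + 1)))"
proof (induction k)
  case 0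
  have "{2 * 2 ^ 0..<3 * 2 ^ 0} = {2::nat}" by auto
  then show ?case using T[of 1] by simp
next
  case (Suc k)
  have "sum T {2 * (2 * 2 ^ k)..<2 * (3 * 2 ^ k)} =
      sum T {2 * 2 ^ k..<3 * 2 ^ k} + sum T {i \<in> {2 * (2 * 2 ^ k)..<2 * (3 * 2 ^ k)}. odd i}"
    by (rule sum_even_odd_split) (rule T)
  also have "sum T {i \<in> {2 * (2 * 2 ^ k)..<2 * (3 * 2 ^ k)}. odd i} =
      (\<Sum>i\<in>Gamma (Suc k). T (i + 2 ^ (Suc k + 1)))"
    by (rule sum.reindex_bij_witness[of _ "\<lambda>i. i + 2 ^ (Suc k + 1)" "\<lambda>i. i - 2 ^ (Suc k + 1)"])
      (auto simp: Gamma_iff)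
  finally show ?case unfolding Suc by (simp add: add.assoc mult.left_commute)
qed

text \<open>Only one halving step: the shorter interval is kept whole because it cancels against an
  equal term of the trace expansion.\<close>

lemma sum_leading_bits_11:
  fixes T :: "nat \<Rightarrow> 'b::comm_monoid_add"
  assumes T: "\<And>n. T (2 * n) = T n"
  shows "sum T {3 * 2 ^ Suc k..<4 * 2 ^ Suc k} = sum T {3 * 2 ^ k..<4 * 2 ^ k} +
    (\<Sum>i\<in>Gamma (k + 2) - Gamma (k + 1). T (i + 2 ^ (k + 2)))"
proof -
  have "sum T {2 * (3 * 2 ^ k)..<2 * (4 * 2 ^ k)} =
      sum T {3 * 2 ^ k..<4 * 2 ^ k} + sum T {i \<in> {2 * (3 * 2 ^ k)..<2 * (4 * 2 ^ k)}. odd i}"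
    by (rule sum_even_odd_split) (rule T)
  also have "sum T {i \<in> {2 * (3 * 2 ^ k)..<2 * (4 * 2 ^ k)}. odd i} =
      (\<Sum>i\<in>Gamma (k + 2) - Gamma (k + 1). T (i + 2 ^ (k + 2)))"
    by (rule sum.reindex_bij_witness[of _ "\<lambda>i. i + 2 ^ (k + 2)" "\<lambda>i. i - 2 ^ (k + 2)"])
      (auto simp: Gamma_iff)
  finally show ?thesis by (simp add: mult.left_commute)
qed

text \<open>Exactly one odd representative for each 2-cyclotomic coset modulo \<open>2 ^ (2 * h) - 1\<close> occurring
  in the spectrum of the sequence: in binary they are the numbers with leading bits 10 and at most
  \<open>h\<close> bits, and those with leading bits 11 and \<open>h + 1\<close> bits.\<close>

definition leaders :: "nat \<Rightarrow> nat set" where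
  "leaders h = (\<lambda>i. i + 2 ^ h) ` (Gamma h - Gamma (h - 1)) \<union>
     (\<Union>j\<in>{1..h - 2}. (\<lambda>i. i + 2 ^ (j + 1)) ` Gamma j)"

lemma leaders_low:
  assumes "j \<in> {1..h - 2}" "i \<in> Gamma j"
  shows "i + 2 ^ (j + 1) < 2 ^ h"
proof -
  have "i + 2 ^ (j + 1) < 2 ^ (j + 2)" using assms(2) by (simp add: Gamma_iff)
  also have "\<dots> \<le> 2 ^ h" using assms(1) by (intro power_increasing) auto
  finally show ?thesis .
qed

lemma leaders_cases:
  assumes "e \<in> leaders h" "h \<ge> 1"
  shows "odd e" "e < 2 ^ (h + 1)" "e < 2 ^ h \<or> 3 * 2 ^ (h - 1) \<le> e"
proof -
  have h: "(2::nat) ^ h = 2 * 2 ^ (h - 1)" using assms(2) by (cases h) auto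
  from assms(1) consider i where "i \<in> Gamma h - Gamma (h - 1)" "e = i + 2 ^ h"
    | j i where "j \<in> {1..h - 2}" "i \<in> Gamma j" "e = i + 2 ^ (j + 1)"
    unfolding leaders_def by auto
  then have "odd e \<and> e < 2 ^ (h + 1) \<and> (e < 2 ^ h \<or> 3 * 2 ^ (h - 1) \<le> e)"
  proof cases
    case 1
    then show ?thesis using h assms(2) by (auto simp: Gamma_iff)
  next
    case 2
    then show ?thesis using leaders_low[OF 2(1,2)] by (auto simp: Gamma_iff)
  qed
  then show "odd e" "e < 2 ^ (h + 1)" "e < 2 ^ h \<or> 3 * 2 ^ (h - 1) \<le> e" by auto
qed

text \<open>Stated for an arbitrary commutative monoid so that it serves sums (trace, counting) and
  products (generator) alike. The blocks are disjoint because their elements have different bit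
  lengths.\<close>

lemma (in comm_monoid_set) leaders_split:
  "F g (leaders h) = f (F (\<lambda>i. g (i + 2 ^ h)) (Gamma h - Gamma (h - 1)))
     (F (\<lambda>j. F (\<lambda>i. g (i + 2 ^ (j + 1))) (Gamma j)) {1..h - 2})"
proof -
  let ?L = "\<lambda>j. (\<lambda>i. i + 2 ^ (j + 1)) ` Gamma j"
  have range: "2 ^ (j + 1) \<le> e \<and> e < 2 ^ (j + 2)" if "e \<in> ?L j" for e j
    using that by (auto simp: Gamma_iff)
  have "?L j \<inter> ?L j' = {}" if "j < j'" for j j'
  proof -
    have "(2::nat) ^ (j + 2) \<le> 2 ^ (j' + 1)" using that by (intro power_increasing) auto
    then show ?thesis using range[of _ j] range[of _ j'] by fastforce
  qed
  then have disj: "?L j \<inter> ?L j' = {}" if "j \<noteq> j'" for j j'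
    using that by (metis inf_commute nat_neq_iff)
  have "F g (leaders h) = f (F g ((\<lambda>i. i + 2 ^ h) ` (Gamma h - Gamma (h - 1))))
      (F g (\<Union>j\<in>{1..h - 2}. ?L j))"
    unfolding leaders_def
    by (rule union_disjoint) (use leaders_low finite_Gamma in \<open>fastforce+\<close>)
  also have "F g (\<Union>j\<in>{1..h - 2}. ?L j) = F (\<lambda>j. F g (?L j)) {1..h - 2}"
    using disj by (intro UNION_disjoint) (auto simp: finite_Gamma)
  finally show ?thesis by (simp add: reindex inj_on_def comp_def)
qed

lemma card_leaders: "card (leaders (k + 2)) = 2 ^ (k + 1) - 1"
proof -
  have "card (Gamma (k + 2) - Gamma (k + 1)) = 2 ^ k"
  proof -
    have "Gamma (k + 1) \<subseteq> Gamma (k + 2)" by (auto simp: Gamma_iff)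
    then show ?thesis by (simp add: card_Diff_subset finite_Gamma card_Gamma)
  qed
  moreover have "(\<Sum>j\<in>{1..k}. card (Gamma j)) = 2 ^ k - 1"
  proof (induction k)
    case (Suc k)
    then show ?case by (simp add: card_Gamma)
  qed simp
  ultimately show ?thesis
    using sum.leaders_split[of "\<lambda>_. 1::nat" "k + 2"] by simp
qed

text \<open>Powers of \<open>a\<close> determine exponents below \<open>2 ^ (2 * h) - 1\<close>.
  Unless \<open>e' * 2 ^ d\<close> exceeds this range, \<open>e = e' * 2 ^ d\<close>, and oddness of
  \<open>e\<close> gives \<open>d = 0\<close>. Overflow needs \<open>d = h\<close> and leading bits
  11 in \<open>e'\<close>.\<close>

lemma conjugate_leader_eq_imp_small_shift:
  fixes a :: "'a::{finite,field}"
  assumes card: "card (UNIV :: 'a set) = 2 ^ (2 * h)" and prim: "primitive a" and h: "h \<ge> 3"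
    and e: "e \<in> leaders h" and e': "e' \<in> leaders h"
    and eq: "a ^ e = a ^ (e' * 2 ^ d)" and d: "d \<le> h"
  shows "d = 0 \<and> e = e'"
proof -
  define k where "k = h - 2"
  have k: "h = k + 2" using h by (simp add: k_def)
  have inj: "i = j" if "a ^ i = a ^ j" "i < 2 ^ (2 * h) - 1" "j < 2 ^ (2 * h) - 1" for i j
    using primitive_power_inj[OF prim] that unfolding card by (auto simp: inj_on_def)
  define q :: nat where "q = 2 ^ k"
  have k1: "k \<ge> 1" using h k by simp
  have "(2::nat) ^ 1 \<le> 2 ^ k" using k1 by (intro power_increasing) auto
  then have q: "q \<ge> 2" by (simp add: q_def)
  have pw: "(2::nat) ^ h = 4 * q" "(2::nat) ^ (h + 1) = 8 * q" "(2::nat) ^ (h - 1) = 2 * q"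
    unfolding k q_def by simp_all
  have pw2: "(2::nat) ^ (2 * h) = 16 * (q * q)"
    unfolding mult_2 power_add pw by simp
  have qq: "2 * q \<le> q * q" using q by simp
  note E = leaders_cases[OF e] leaders_cases[OF e']
  have less: "e < 8 * q" "e' < 8 * q" "e' < 4 * q \<or> 6 * q \<le> e'" "odd e" "odd e'"
    using E h unfolding pw pw2 by auto
  have ev: "e < 2 ^ (2 * h) - 1" using less(1) qq q unfolding pw pw2 by linarith
  have odd_imp: "d = 0 \<and> e = e'" if "e' * 2 ^ d < 2 ^ (2 * h) - 1"
  proof -
    have "e = e' * 2 ^ d" using inj[OF eq ev that] .
    then show ?thesis using less(4) by (cases d) auto
  qed
  show ?thesis
  proof (cases "d < h")
    case True
    then have "(2::nat) ^ d \<le> 2 ^ (h - 1)" by (intro power_increasing) auto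
    then have "e' * 2 ^ d \<le> (8 * q - 1) * (2 * q)"
      using less(2) unfolding pw pw2 by (intro mult_mono) auto
    also have "\<dots> = 16 * (q * q) - 2 * q" by (simp add: algebra_simps)
    also have "\<dots> < 2 ^ (2 * h) - 1" using q qq unfolding pw pw2 by linarith
    finally show ?thesis by (rule odd_imp)
  next
    case False
    then have dh: "d = h" using d by simp
    show ?thesis
    proof (cases "e' < 4 * q")
      case True
      then have "e' * 2 ^ d \<le> (4 * q - 1) * (4 * q)" unfolding dh pw by (intro mult_mono) auto
      also have "\<dots> = 16 * (q * q) - 4 * q" by (simp add: algebra_simps)
      also have "\<dots> < 2 ^ (2 * h) - 1" using q qq unfolding pw pw2 by linarith
      finally show ?thesis by (rule odd_imp)
    next
      case False
      \<comment> \<open>\<open>f\<close> is \<open>e'\<close> without its top bit. That bit wraps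
        around to the units place, so the reduced exponent is \<open>1 + f * 2 ^ h\<close>, which is
        too large to be a leader.\<close>
      define f where "f = e' - 4 * q"
      have f: "e' = 4 * q + f" "2 * q \<le> f" "f < 4 * q" using False less(2,3) by (auto simp: f_def)
      have "e' * 2 ^ d = 2 ^ (2 * h) + f * (4 * q)"
        unfolding dh pw pw2 f(1) by (simp add: algebra_simps)
      then have "a ^ (e' * 2 ^ d) = a ^ 2 ^ (2 * h) * a ^ (f * (4 * q))"
        by (simp add: power_add)
      then have eq': "a ^ e = a ^ (1 + f * (4 * q))"
        using eq power_card[of a] unfolding card by simp
      have "f * (4 * q) \<le> (4 * q - 1) * (4 * q)" using f(3) by (intro mult_mono) auto
      also have "\<dots> = 16 * (q * q) - 4 * q" by (simp add: algebra_simps)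
      finally have "1 + f * (4 * q) < 2 ^ (2 * h) - 1" using q qq unfolding pw pw2 by linarith
      then have "e = 1 + f * (4 * q)" by (rule inj[OF eq' ev])
      moreover have "(2 * q) * (4 * q) \<le> f * (4 * q)" using f(2) by (rule mult_right_mono) simp
      ultimately show ?thesis using less(1) qq by (simp add: algebra_simps)
    qed
  qed
qed

text \<open>Injectivity on pairs says both that different leaders lie in different cosets and that
  every coset has full size. Cancelling a common Frobenius power leaves a single shift
  \<open>d\<close>.\<close>

lemma conjugates_of_leaders_distinct:
  fixes a :: "'a::{finite,field}"
  assumes card: "card (UNIV :: 'a set) = 2 ^ (2 * h)" and prim: "primitive a" and h: "h \<ge> 3"
  shows "inj_on (\<lambda>(e, k). a ^ (e * 2 ^ k)) (leaders h \<times> {..<2 * h})"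
proof -
  note two = two_eq_zero_if_card[OF card]
  have main: "k = k' \<and> e = e'"
    if "e \<in> leaders h" "e' \<in> leaders h" "k' < 2 * h" "k \<le> k'"
      and eq: "a ^ (e * 2 ^ k) = a ^ (e' * 2 ^ k')" for e e' k k'
  proof -
    define d where "d = k' - k"
    have d: "k' = d + k" "d < 2 * h" using that by (auto simp: d_def)
    have "(a ^ e) ^ 2 ^ k = (a ^ (e' * 2 ^ d)) ^ 2 ^ k"
      using eq unfolding d(1) by (simp add: power_mult[symmetric] power_add mult.assoc)
    then have eq1: "a ^ e = a ^ (e' * 2 ^ d)" by (simp add: power_two_power_inj[OF two])
    show ?thesis
    proof (cases "d \<le> h")
      case True
      then show ?thesis
        using conjugate_leader_eq_imp_small_shift[OF card prim h that(1,2) eq1] d by simp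
    next
      case False
      \<comment> \<open>A shift beyond \<open>h\<close> is completed to a full cycle, which swaps
        \<open>e\<close> and \<open>e'\<close> and leaves the shift \<open>2 * h - d\<close> below
        \<open>h\<close>.\<close>
      have "a ^ (e * 2 ^ (2 * h - d)) = (a ^ (e' * 2 ^ d)) ^ 2 ^ (2 * h - d)"
        using eq1 by (simp add: power_mult)
      also have "\<dots> = a ^ (e' * 2 ^ (d + (2 * h - d)))"
        by (simp only: power_mult[symmetric] power_add mult.assoc)
      also have "\<dots> = (a ^ e') ^ 2 ^ (2 * h)"
        using d by (simp add: power_mult)
      also have "\<dots> = a ^ e'" using power_card[of "a ^ e'"] unfolding card .
      finally have "2 * h - d = 0 \<and> e' = e"
        using False by (intro conjugate_leader_eq_imp_small_shift[OF card prim h that(2,1)]) auto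
      then show ?thesis using d by simp
    qed
  qed
  show ?thesis
  proof (rule inj_onI)
    fix p p' assume p: "p \<in> leaders h \<times> {..<2 * h}" "p' \<in> leaders h \<times> {..<2 * h}"
      "(case p of (e, k) \<Rightarrow> a ^ (e * 2 ^ k)) = (case p' of (e, k) \<Rightarrow> a ^ (e * 2 ^ k))"
    obtain e k e' k' where [simp]: "p = (e, k)" "p' = (e', k')" by (cases p, cases p')
    have *: "e \<in> leaders h" "e' \<in> leaders h" "k < 2 * h" "k' < 2 * h"
      "a ^ (e * 2 ^ k) = a ^ (e' * 2 ^ k')" using p by auto
    show "p = p'"
    proof (cases "k \<le> k'")
      case True
      then show ?thesis using main[OF *(1,2) _ True *(5)] *(4) by simp
    next
      case False
      then have "k' = k \<and> e' = e" using *(3) by (intro main[OF *(2,1) _ _ *(5)[symmetric]]) auto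
      then show ?thesis by simp
    qed
  qed
qed

subsection \<open>The trace expansion of the sequence\<close>

text \<open>Doubling: the factor \<open>(x + 1) ^ 2 ^ k = x ^ 2 ^ k + 1\<close> appends a shifted
  copy of the sum.\<close>

lemma power_two_power_minus_one:
  assumes two: "(2::'a::field) = 0"
  shows "(x + 1) ^ (2 ^ k - 1) = (\<Sum>i<2 ^ k. x ^ i :: 'a)"
proof (induction k)
  case (Suc k)
  have split: "(\<Sum>i<n + l. x ^ i) = (\<Sum>i<n. x ^ i) + (\<Sum>i<l. x ^ (n + i))" for n l
    by (induction l) (auto simp: add.assoc)
  have "(2::nat) ^ Suc k - 1 = 2 ^ k + (2 ^ k - 1)"
    by simp
  then have "(x + 1) ^ (2 ^ Suc k - 1) = (x + 1) ^ 2 ^ k * (x + 1) ^ (2 ^ k - 1)"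
    by (simp only: power_add)
  also have "\<dots> = (x ^ 2 ^ k + 1) * (\<Sum>i<2 ^ k. x ^ i)"
    unfolding Suc using power_two_power_add[OF two, of x 1 k] by simp
  also have "\<dots> = (\<Sum>i<2 ^ k. x ^ i) + (\<Sum>i<2 ^ k. x ^ (2 ^ k + i))"
    by (simp add: power_add sum_distrib_left distrib_right sum.distrib)
  also have "\<dots> = (\<Sum>i<2 ^ k + 2 ^ k. x ^ i)" by (rule split[symmetric])
  finally show ?case by (simp add: mult_2)
qed simp

context
  fixes m :: nat
  assumes card: "card (UNIV :: 'a::{finite,field} set) = 2 ^ m"
begin

lemma trace_add: "trace m (x + y) = trace m x + trace m (y::'a)"
  unfolding trace_def power_two_power_add[OF two_eq_zero_if_card[OF card]] by (rule sum.distrib)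

lemma trace_sum: "trace m (sum f A) = (\<Sum>i\<in>A. trace m (f i :: 'a))"
proof -
  have "trace m (0::'a) = 0" by (simp add: trace_def power_0_left)
  then show ?thesis by (induction A rule: infinite_finite_induct) (auto simp: trace_add)
qed

lemma trace_square: "trace m (x\<^sup>2) = trace m (x::'a)"
proof -
  \<comment> \<open>Adding \<open>x\<close> completes the shifted sum; its last term
    \<open>x ^ 2 ^ m\<close> is again \<open>x\<close>.\<close>
  have "x + (\<Sum>i<m. x ^ 2 ^ Suc i) = (\<Sum>i<Suc m. x ^ 2 ^ i)"
    by (subst sum.lessThan_Suc_shift) simp
  also have "\<dots> = x + (\<Sum>i<m. x ^ 2 ^ i)"
    using power_card[of x] unfolding card by (simp add: add.commute)
  finally show ?thesis unfolding trace_def by (simp add: power_mult)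
qed

lemma trace_conjugate: "trace m (x ^ 2 ^ k) = trace m (x::'a)"
  by (induction k) (auto simp: power_mult trace_square mult.commute[of 2])

end

lemma trace_f7_shift:
  fixes x :: "'a::{finite,field}"
  assumes card: "card (UNIV :: 'a set) = 2 ^ m" and m: "m = 2 * h" and h: "h = k + 2"
  shows "trace m (f7 m (x + 1)) = (\<Sum>e\<in>leaders h. trace m (x ^ e))"
proof -
  note two = two_eq_zero_if_card[OF card]
  define q :: nat where "q = 2 ^ k"
  define T where "T n = trace m (x ^ n)" for n
  have pw: "(2::nat) ^ h = 4 * q" "(2::nat) ^ (h + 1) = 8 * q" "(2::nat) ^ (h - 1) = 2 * q"
    unfolding h q_def by simp_all
  have pw2: "(2::nat) ^ m = 16 * (q * q)"
    unfolding m mult_2 power_add pw by simp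
  have q: "q \<ge> 1" by (simp add: q_def)
  have T2: "T (2 * n) = T n" for n
    unfolding T_def using trace_square[OF card, of "x ^ n"]
    by (simp add: power_mult[symmetric] mult.commute)
  have T2k: "T (n * 2 ^ l) = T n" for n l
    unfolding T_def using trace_conjugate[OF card, of "x ^ n" l] by (simp add: power_mult)
  \<comment> \<open>The trace of 1 is \<open>m\<close> copies of 1, which vanish because
    \<open>m\<close> is even.\<close>
  have T0: "T 0 = 0" unfolding T_def trace_def m by (simp add: two)
  have t1: "trace m (x + 1) = T 1"
    using T0 trace_add[OF card, of x 1] by (simp add: T_def)
  have t2: "trace m ((x + 1) ^ (2 ^ (h + 1) - 1)) = (\<Sum>i<8 * q. T i)"
    unfolding power_two_power_minus_one[OF two] trace_sum[OF card] unfolding T_def pw ..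
  have t3: "trace m ((x + 1) ^ (2 ^ m - 2 ^ (h + 1) + 2)) =
      (\<Sum>j<2 * q. T j) + (\<Sum>j<2 * q. T (j + 4 * q))"
  proof -
    \<comment> \<open>Multiplying the exponent by \<open>2 ^ h\<close> is a half turn of its cyclic
      binary expansion: it moves \<open>j\<close> to the low end and the bit 1 to
      \<open>2 ^ h\<close>.\<close>
    have shift: "T (1 + j * 2 ^ h) = T (j + 4 * q)" for j
    proof -
      have "T (1 + j * 2 ^ h) = T ((1 + j * 2 ^ h) * 2 ^ h)" by (rule T2k[symmetric])
      also have "(1 + j * 2 ^ h) * 2 ^ h = j * 2 ^ m + 4 * q"
        unfolding pw pw2 by (simp add: algebra_simps)
      also have "T \<dots> = T (j + 4 * q)"
        using power_card[of "x ^ j"] unfolding T_def card by (simp add: power_add power_mult)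
      finally show ?thesis .
    qed
    \<comment> \<open>The factor 2 is invisible to the trace; the rest separates one factor
      \<open>x + 1\<close> from a power of \<open>(x + 1) ^ 2 ^ h\<close> with exponent of the form
      \<open>2 ^ n - 1\<close>.\<close>
    have "2 ^ m - 2 ^ (h + 1) + 2 = (1 + 2 ^ h * (2 ^ (h - 1) - 1)) * (2::nat)"
      unfolding pw pw2 using q by (simp add: algebra_simps)
    then have "trace m ((x + 1) ^ (2 ^ m - 2 ^ (h + 1) + 2)) =
        trace m (((x + 1) ^ (1 + 2 ^ h * (2 ^ (h - 1) - 1)))\<^sup>2)"
      by (simp only: power_mult)
    also have "\<dots> = trace m ((x + 1) * ((x + 1) ^ 2 ^ h) ^ (2 ^ (h - 1) - 1))"
      unfolding trace_square[OF card] by (simp add: power_add power_mult)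
    also have "(x + 1) ^ 2 ^ h = x ^ 2 ^ h + 1"
      using power_two_power_add[OF two, of x 1 h] by simp
    also have "(x ^ 2 ^ h + 1) ^ (2 ^ (h - 1) - 1) = (\<Sum>j<2 * q. (x ^ 2 ^ h) ^ j)"
      unfolding power_two_power_minus_one[OF two] unfolding pw ..
    also have "(x + 1) * \<dots> = (\<Sum>j<2 * q. x ^ (j * 2 ^ h)) + (\<Sum>j<2 * q. x ^ (1 + j * 2 ^ h))"
      by (simp add: distrib_right sum_distrib_left sum.distrib power_mult[symmetric]
          mult.commute add.commute)
    also have "trace m \<dots> = (\<Sum>j<2 * q. T (j * 2 ^ h)) + (\<Sum>j<2 * q. T (1 + j * 2 ^ h))"
      unfolding trace_add[OF card] trace_sum[OF card] T_def ..
    finally show ?thesis unfolding T2k shift .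
  qed
  \<comment> \<open>The cuts isolate \<open>[0, 2q)\<close> and \<open>[4q, 6q)\<close>, which also
    come from the third term, and \<open>[3q, 4q)\<close>, which is half of
    \<open>[6q, 8q)\<close>.\<close>
  have sp: "sum T {..<8 * q} = sum T {..<2 * q} + (sum T {2 * q..<3 * q} + sum T {3 * q..<4 * q}
      + sum T {4 * q..<6 * q} + sum T {6 * q..<8 * q})"
    by (simp add: sum.atLeastLessThan_concat lessThan_atLeast0 add.assoc)
  have sh: "(\<Sum>j<2 * q. T (j + 4 * q)) = sum T {4 * q..<6 * q}"
    by (rule sum.reindex_bij_witness[of _ "\<lambda>j. j - 4 * q" "\<lambda>j. j + 4 * q"]) auto
  have A: "sum T {2 * q..<3 * q} = T 1 + (\<Sum>j\<in>{1..k}. \<Sum>i\<in>Gamma j. T (i + 2 ^ (j + 1)))"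
    unfolding q_def by (rule sum_leading_bits_10) (rule T2)
  have B: "sum T {6 * q..<8 * q} = sum T {3 * q..<4 * q} +
      (\<Sum>i\<in>Gamma (k + 2) - Gamma (k + 1). T (i + 2 ^ (k + 2)))"
    using sum_leading_bits_11[of T k, OF T2] unfolding q_def by simp
  have cancel: "u + (u + w) = w" for u w :: 'a
    using add_self[OF two, of u] by (simp add: add.assoc[symmetric])
  have "trace m (f7 m (x + 1)) = T 1 + sum T {..<8 * q} +
      (sum T {..<2 * q} + sum T {4 * q..<6 * q})"
    unfolding f7_def trace_add[OF card] t1[symmetric] t2[symmetric] t3[unfolded sh, symmetric]
    using m by simp
  \<comment> \<open>Each of \<open>T 1\<close> and the sums over \<open>[0, 2q)\<close>,
    \<open>[3q, 4q)\<close> and \<open>[4q, 6q)\<close> occurs twice and vanishes.\<close>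
  also have "\<dots> = (\<Sum>i\<in>Gamma (k + 2) - Gamma (k + 1). T (i + 2 ^ (k + 2))) +
      (\<Sum>j\<in>{1..k}. \<Sum>i\<in>Gamma j. T (i + 2 ^ (j + 1)))"
    unfolding sp A B by (simp only: add_ac cancel)
  also have "\<dots> = sum T (leaders h)"
    unfolding sum.leaders_split h by simp
  finally show ?thesis by (simp add: T_def)
qed

section \<open>Zeros, dimension and distance bounds of the code\<close>

theorem theorem7:
  fixes \<alpha> :: "'a::{finite,field}" and m h :: nat and s :: "nat \<Rightarrow> 'a"
  assumes "card (UNIV :: 'a set) = 2 ^ m"
    and "m \<ge> 6" and "even m" and "h = m div 2"
    and "primitive \<alpha>"
    and "\<And>t. s t = trace m (f7 m (\<alpha> ^ t + 1))"
  shows "(seq_min_poly s =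
           (\<Prod>i\<in>Gamma h - Gamma (h - 1). min_poly_F2 (inverse \<alpha> ^ (i + 2 ^ h))) *
           (\<Prod>j\<in>{1..h - 2}. \<Prod>i\<in>Gamma j. min_poly_F2 (inverse \<alpha> ^ (i + 2 ^ (j + 1))))) \<and>
    linear_span s = m * (2 ^ ((m - 2) div 2) - 1) \<and>
    card (cyclic_code (2 ^ m - 1) (seq_min_poly s)) = 2 ^ (2 ^ m - 1 - m * (2 ^ ((m - 2) div 2) - 1)) \<and>
    2 ^ ((m - 4) div 2) + 1 \<le> min_dist (2 ^ m - 1) (cyclic_code (2 ^ m - 1) (seq_min_poly s)) \<and>
    min_dist (2 ^ m - 1) (cyclic_code (2 ^ m - 1) (seq_min_poly s)) \<le> 1 + m * (2 ^ ((m - 2) div 2) - 1)"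
proof -
  define k where "k = h - 2"
  have m: "m = 2 * h" and h: "h \<ge> 3" and hk: "h = k + 2"
    using assms(2-4) by (auto simp: k_def)
  note card = assms(1)
  note card2 = card[unfolded m]
  note two = two_eq_zero_if_card[OF card]
  note prim = assms(5)
  define \<beta> where "\<beta> = inverse \<alpha>"
  have \<alpha>0: "\<alpha> \<noteq> 0" using prim by (simp add: primitive_def)
  then have \<beta>0: "\<beta> \<noteq> 0" by (simp add: \<beta>_def)
  have \<beta>card: "(\<beta> ^ e) ^ 2 ^ m = \<beta> ^ e" for e using power_card[of "\<beta> ^ e"] unfolding card .
  let ?P = "leaders h \<times> {..<m}"
  \<comment> \<open>The reciprocals of all ratios in the trace expansion, that is, all conjugates of
    the powers \<open>\<beta> ^ e\<close> for leaders \<open>e\<close>.\<close>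
  define R where "R = (\<lambda>(e, k). \<beta> ^ (e * 2 ^ k)) ` ?P"
  have inj: "inj_on (\<lambda>(e, k). \<beta> ^ (e * 2 ^ k)) ?P"
    using conjugates_of_leaders_distinct[OF card2 prim h] unfolding m
    by (auto simp: inj_on_def \<beta>_def power_inverse)
  have R0: "0 \<notin> R" using \<beta>0 by (auto simp: R_def)
  have sq: "(\<lambda>r. r\<^sup>2) ` R \<subseteq> R"
  proof clarify
    fix r assume "r \<in> R"
    then obtain e i where r: "e \<in> leaders h" "i < m" "r = \<beta> ^ (e * 2 ^ i)" by (auto simp: R_def)
    have r2: "r\<^sup>2 = \<beta> ^ (e * 2 ^ Suc i)" unfolding r by (simp add: power_mult[symmetric] mult_ac)
    show "r\<^sup>2 \<in> R"
    proof (cases "Suc i = m")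
      case True
      then have "r\<^sup>2 = \<beta> ^ (e * 2 ^ 0)" using r2 \<beta>card[of e] by (simp add: power_mult)
      then show ?thesis unfolding R_def using r by (intro image_eqI[of _ _ "(e, 0)"]) auto
    next
      case False
      then show ?thesis unfolding R_def using r r2 by (intro image_eqI[of _ _ "(e, Suc i)"]) auto
    qed
  qed
  have bin: "binary_poly (root_poly R)" using sq by (intro binary_root_poly[OF two]) auto
  have s: "s t = (\<Sum>r\<in>R. inverse r ^ t)" for t
  proof -
    have "s t = (\<Sum>e\<in>leaders h. \<Sum>i<m. ((\<alpha> ^ t) ^ e) ^ 2 ^ i)"
      unfolding assms(6) trace_f7_shift[OF card m hk] by (simp add: trace_def)
    also have "\<dots> = (\<Sum>(e, i)\<in>?P. inverse (\<beta> ^ (e * 2 ^ i)) ^ t)"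
      unfolding sum.cartesian_product
      by (intro sum.cong refl)
        (auto simp: \<beta>_def power_inverse power_mult[symmetric] mult_ac)
    also have "\<dots> = (\<Sum>r\<in>R. inverse r ^ t)"
      unfolding R_def by (subst sum.reindex[OF inj]) (auto intro!: sum.cong)
    finally show ?thesis .
  qed
  have min: "seq_min_poly s = root_poly R"
    by (rule seq_min_poly_power_sum[OF _ R0 s bin]) simp
  have "root_poly R = (\<Prod>(e, i)\<in>?P. [:- (\<beta> ^ (e * 2 ^ i)), 1:])"
    unfolding root_poly_def R_def by (subst prod.reindex[OF inj]) (auto intro!: prod.cong)
  also have "\<dots> = (\<Prod>e\<in>leaders h. \<Prod>i<m. [:- (\<beta> ^ (e * 2 ^ i)), 1:])"
    by (rule prod.cartesian_product[symmetric])
  also have "\<dots> = (\<Prod>e\<in>leaders h. min_poly_F2 (\<beta> ^ e))"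
  proof (rule prod.cong[OF refl])
    fix e assume e: "e \<in> leaders h"
    have "inj_on (\<lambda>i. (\<beta> ^ e) ^ 2 ^ i) {..<m}"
      using inj e by (auto simp: inj_on_def power_mult)
    then have "(\<Prod>i<m. [:- (\<beta> ^ (e * 2 ^ i)), 1:]) = root_poly ((\<lambda>i. (\<beta> ^ e) ^ 2 ^ i) ` {..<m})"
      unfolding root_poly_def by (subst prod.reindex) (auto simp: power_mult)
    also have "\<dots> = min_poly_F2 (\<beta> ^ e)"
      using h m by (intro min_poly_F2_eq[OF two, symmetric] \<beta>card) auto
    finally show "(\<Prod>i<m. [:- (\<beta> ^ (e * 2 ^ i)), 1:]) = min_poly_F2 (\<beta> ^ e)" .
  qed
  finally have factors: "root_poly R = (\<Prod>e\<in>leaders h. min_poly_F2 (\<beta> ^ e))" .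
  have cardR: "card R = m * (2 ^ ((m - 2) div 2) - 1)"
  proof -
    have "card R = card (leaders h) * m"
      unfolding R_def by (simp add: card_image[OF inj] card_cartesian_product)
    also have "card (leaders h) = 2 ^ (k + 1) - 1" unfolding hk by (rule card_leaders)
    also have "k + 1 = (m - 2) div 2" using m hk by simp
    finally show ?thesis by (simp add: mult.commute)
  qed
  define v where "v = card (UNIV :: 'a set) - 1"
  have v: "v = 2 ^ m - 1" by (simp add: v_def card)
  \<comment> \<open>Since \<open>m = 2 * h\<close>, the degree is \<open>h * (2 ^ h - 2)\<close>,
    and the crude estimate \<open>h \<le> 2 ^ h\<close> keeps it below the length.\<close>
  have small: "card R < v"
  proof -
    have "card R = h * (2 ^ h - 2)" unfolding cardR using m hk by (simp add: algebra_simps)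
    also have "\<dots> \<le> 2 ^ h * (2 ^ h - 2)" by (intro mult_right_mono) (auto intro: less_imp_le)
    also have "\<dots> = 2 ^ m - 2 * 2 ^ h" unfolding m by (simp add: mult_2 power_add right_diff_distrib')
    also have "\<dots> < v"
    proof -
      have "(0::nat) < 2 ^ h" by simp
      moreover have "(2::nat) ^ 2 \<le> 2 ^ m" using assms(2) by (intro power_increasing) auto
      ultimately show ?thesis unfolding v power2_eq_square by linarith
    qed
    finally show ?thesis .
  qed
  note code = two R0 sq v_def
  have lower: "2 ^ ((m - 4) div 2) + 1 \<le> min_dist v (cyclic_code v (root_poly R))"
  proof (rule BCH_bound[OF code small])
    \<comment> \<open>Ratio \<open>\<beta>\<^sup>2\<close> steps through odd exponents; its powers
      stay distinct because squaring is injective.\<close>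
    have "(\<beta>\<^sup>2) ^ i = inverse ((\<alpha> ^ i)\<^sup>2)" for i
      by (simp add: \<beta>_def power_inverse power_mult[symmetric] mult.commute)
    then show "inj_on (\<lambda>i. (\<beta>\<^sup>2) ^ i) {..<v}"
      using primitive_power_inj[OF prim] by (simp add: inj_on_def v_def square_inj[OF two])
    show "\<beta> ^ (3 * 2 ^ (k + 1) + 1) \<noteq> 0" using \<beta>0 by simp
  next
    fix j :: nat assume j: "j < 2 ^ ((m - 4) div 2)"
    then have j: "j < 2 ^ k" using m hk by simp
    \<comment> \<open>\<open>?i + 2 ^ h\<close> is the odd number with index \<open>j\<close> in
      \<open>[3 * 2 ^ (h - 1), 2 ^ (h + 1))\<close>, counting from 0; there are \<open>2 ^ k\<close>
      of them.\<close>
    let ?i = "2 ^ (k + 1) + 1 + 2 * j"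
    have "?i \<in> Gamma h - Gamma (h - 1)" using j by (auto simp: Gamma_iff hk)
    then have "?i + 2 ^ h \<in> leaders h" unfolding leaders_def by blast
    then have "\<beta> ^ ((?i + 2 ^ h) * 2 ^ 0) \<in> R"
      unfolding R_def using h m by (intro image_eqI[of _ _ "(?i + 2 ^ h, 0)"]) auto
    also have "(?i + 2 ^ h) * 2 ^ 0 = 3 * 2 ^ (k + 1) + 1 + 2 * j" by (simp add: hk)
    finally show "\<beta> ^ (3 * 2 ^ (k + 1) + 1) * (\<beta>\<^sup>2) ^ j \<in> R"
      by (simp add: power_add power_mult mult.assoc)
  qed
  show ?thesis
    using factors lower min_dist_cyclic_code_le[OF code small]
      card_cyclic_code_root_poly[OF code] degree_root_poly[of R]
    unfolding linear_span_def min prod.leaders_split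
    by (simp add: cardR v \<beta>_def)
qed

end
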